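(* Let $D_1\subset\mathbb{C}^n$ and $D_2\subset\mathbb{C}^m$ be pseudoconvex quasi-balanced domains. If $f:D_1\to D_2$ is holomorphic and $f(0)=0$, then $$\big(\mathfrak{h}_{D_2}(f(z))\big)^{p}\le\mathfrak{h}_{D_1}(z)\qquad\text{for all } z\in D_1,$$ where $p$ is the highest weight of the quasi-balanced domain $D_2$.
   Context: Let $p_1,\dots,p_n$ be relatively prime positive integers (the weights). For $\lambda\in\mathbb{C}$ and $z=(z_1,\dots,z_n)\in\mathbb{C}^n$ put $\lambda\bullet z:=(\lambda^{p_1}z_1,\dots,\lambda^{p_n}z_n)$. A domain $D\subset\mathbb{C}^n$ is $(p_1,\dots,p_n)$-balanced (quasi-balanced) if $\lambda\bullet z\in D$ for all $z\in D$ and all $\lambda\in\mathbb{C}$ with $|\lambda|\le1$. Its Minkowski function (with respect to these weights) is $\mathfrak{h}_D(z):=\inf\{t>0:\tfrac1t\bullet z\in D\}$ for $z\in\mathbb{C}^n$. The highest weight is $\max_i p_i$. Each of $D_1$, $D_2$ is quasi-balanced with respect to its own fixed system of weights, and $\mathfrak{h}_{D_1},\mathfrak{h}_{D_2}$ are taken with respect to these weights. *)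

theory Defs
  imports "HOL-Analysis.Analysis"
begin

definition cdomain :: "(complex ^ 'n) set \<Rightarrow> bool" where
  "cdomain D \<longleftrightarrow> open D \<and> connected D \<and> D \<noteq> {}"

text \<open>Complex differentiability: the real Frechet derivative exists at every point and is
  complex linear. Intended for open \<open>D\<close>.\<close>

definition holomorphic_map_on :: "(complex ^ 'n \<Rightarrow> complex ^ 'm) \<Rightarrow> (complex ^ 'n) set \<Rightarrow> bool" where
  "holomorphic_map_on f D \<longleftrightarrow>
     (\<forall>z\<in>D. \<exists>f'. (f has_derivative f') (at z) \<and> (\<forall>c v. f' (c *s v) = c *s f' v))"

text \<open>Continuous, real-valued plurisubharmonic functions, through the sub-mean value property
  on all closed discs in complex lines that are contained in \<open>D\<close>. Continuity makes the integrand
  integrable, so the integral is the genuine one.\<close>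

definition continuous_psh_on :: "(complex ^ 'n) set \<Rightarrow> (complex ^ 'n \<Rightarrow> real) \<Rightarrow> bool" where
  "continuous_psh_on D u \<longleftrightarrow> continuous_on D u \<and>
     (\<forall>a b. (\<forall>\<mu>::complex. norm \<mu> \<le> 1 \<longrightarrow> a + \<mu> *s b \<in> D) \<longrightarrow>
        u a \<le> 1 / (2 * pi) * integral {0..2 * pi} (\<lambda>\<theta>. u (a + cis \<theta> *s b)))"

text \<open>Existence of a continuous plurisubharmonic exhaustion function.\<close>

definition pseudoconvex :: "(complex ^ 'n) set \<Rightarrow> bool" where
  "pseudoconvex D \<longleftrightarrow>
     (\<exists>u. continuous_psh_on D u \<and> (\<forall>c::real. compact {z \<in> D. u z \<le> c}))"

text \<open>Weights are relatively prime as a system; they need not be pairwise coprime.\<close>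

definition weights :: "('n::finite \<Rightarrow> nat) \<Rightarrow> bool" where
  "weights p \<longleftrightarrow> (\<forall>i. 0 < p i) \<and> Gcd (range p) = 1"

definition wscale :: "('n \<Rightarrow> nat) \<Rightarrow> complex \<Rightarrow> complex ^ 'n \<Rightarrow> complex ^ 'n" where
  "wscale p \<mu> z = (\<chi> i. \<mu> ^ p i * z $ i)"

definition quasi_balanced :: "('n \<Rightarrow> nat) \<Rightarrow> (complex ^ 'n) set \<Rightarrow> bool" where
  "quasi_balanced p D \<longleftrightarrow> (\<forall>z\<in>D. \<forall>\<mu>. norm \<mu> \<le> 1 \<longrightarrow> wscale p \<mu> z \<in> D)"

definition minkowski :: "('n \<Rightarrow> nat) \<Rightarrow> (complex ^ 'n) set \<Rightarrow> complex ^ 'n \<Rightarrow> real" where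
  "minkowski p D z = Inf {t::real. 0 < t \<and> wscale p (complex_of_real (1 / t)) z \<in> D}"

definition highest_weight :: "('n::finite \<Rightarrow> nat) \<Rightarrow> nat" where
  "highest_weight p = Max (range p)"

end

theory Submission imports Defs "HOL-Complex_Analysis.Cauchy_Integral_Formula" begin

text \<open>
  The theorem is the Schwarz lemma, applied after a branched change of variable. Write
  \<open>\<mu> \<bullet> z\<close> for \<open>wscale p \<mu> z\<close> and let \<open>P\<close> be the highest weight of \<open>D2\<close>. If
  \<open>0 < t \<le> 1\<close> and \<open>w = (1/t) \<bullet> z\<close> lies in \<open>D1\<close>, then \<open>\<phi> \<zeta> = f (\<zeta> \<bullet> w)\<close> maps the
  closed unit disc into \<open>D2\<close>, with \<open>\<phi> 0 = 0\<close> and \<open>\<phi> t = f z\<close>. Each component is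
  \<open>\<zeta> \<psi>\<^sub>j(\<zeta>)\<close> with \<open>\<psi>\<^sub>j\<close> holomorphic, and substituting \<open>\<zeta> = \<mu>^P\<close> gives
  \<open>\<phi> (\<mu>^P) = \<mu> \<bullet> g \<mu>\<close>, where \<open>g\<close> has the components \<open>\<mu>^(P - p\<^sub>j) \<psi>\<^sub>j(\<mu>^P)\<close>. These are
  holomorphic because no weight exceeds \<open>P\<close>. On the unit circle \<open>g \<mu>\<close> is a rotation of
  \<open>\<phi> (\<mu>^P)\<close>, so it lies in \<open>D2\<close>. If the whole disc \<open>g\<close> lies in \<open>D2\<close>, then
  \<open>\<mu> = root P t\<close> yields \<open>(1/\<mu>) \<bullet> f z = g \<mu> \<in> D2\<close>, that is, the Minkowski function of
  \<open>D2\<close> at \<open>f z\<close> is at most \<open>root P t\<close>; it remains to take the infimum over \<open>t\<close>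
  (\<open>quasi_balanced_schwarz\<close>).

  That an analytic disc with boundary in \<open>D2\<close> lies in \<open>D2\<close> is where pseudoconvexity enters,
  through the continuity principle: the discs \<open>\<mu> \<mapsto> s \<bullet> g \<mu>\<close>, \<open>0 \<le> s \<le> 1\<close>, start at the
  constant disc \<open>0\<close> and have boundaries in a compact part of \<open>D2\<close>, so by the maximum
  principle for the exhaustion function they cannot leave a fixed compact sublevel set
  (\<open>pseudoconvex_continuity_principle\<close>, \<open>quasi_balanced_disc_filling\<close>).

  Plurisubharmonicity is given only on affine discs, and the exhaustion function \<open>u\<close> is only
  continuous, so the maximum principle for \<open>u \<circ> g\<close> along a curved disc \<open>g\<close> needs an argument.
  It uses the penalised function
  \<open>u (g \<mu> + w) - N |w|^2 + \<epsilon> |\<mu>|^2\<close> of the two variables \<open>\<mu>\<close>, \<open>w\<close>.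
  At a maximum the variable \<open>w\<close> can absorb the difference between \<open>g\<close> and its tangent line, which
  bounds \<open>u\<close> from above on an affine disc; that bound violates the sub-mean value inequality
  (\<open>no_touching_disc\<close>, \<open>psh_maximum_principle\<close>).
\<close>

section \<open>Complex curves and circle means\<close>

lemma norm_complex_scalar_mult: "norm (c *s v) = norm c * norm v" for v :: "complex ^ 'n"
  by (simp add: norm_vec_def norm_mult L2_set_right_distrib)

lemma continuous_on_complex_scalar_mult [continuous_intros]:
  fixes v :: "'a::topological_space \<Rightarrow> complex ^ 'n"
  assumes "continuous_on S c" and "continuous_on S v"
  shows "continuous_on S (\<lambda>x. c x *s v x)"
  unfolding vector_scalar_mult_def using assms by (auto intro!: continuous_intros)

lemma mean_value_circle:
  fixes H :: "complex \<Rightarrow> complex"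
  assumes "H holomorphic_on cball z r" "0 < r"
  shows "((\<lambda>\<theta>. H (z + r * cis \<theta>)) has_integral 2 * pi * H z) {0..2 * pi}"
proof -
  have "((\<lambda>u. H u / (u - z)) has_contour_integral 2 * pi * \<i> * H z) (part_circlepath z r 0 (2 * pi))"
    using Cauchy_integral_circlepath_simple[OF assms(1), of z] \<open>0 < r\<close> by (simp add: circlepath_def)
  then have "((\<lambda>\<theta>. H (z + r * cis \<theta>) / (z + r * cis \<theta> - z) * r * \<i> * cis \<theta>)
      has_integral 2 * pi * \<i> * H z) {0..2 * pi}"
    by (subst (asm) has_contour_integral_part_circlepath_iff) auto
  then have "((\<lambda>\<theta>. -\<i> * (H (z + r * cis \<theta>) / (z + r * cis \<theta> - z) * r * \<i> * cis \<theta>))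
      has_integral -\<i> * (2 * pi * \<i> * H z)) {0..2 * pi}"
    by (rule has_integral_mult_right)
  moreover have "-\<i> * (H (z + r * cis \<theta>) / (z + r * cis \<theta> - z) * r * \<i> * cis \<theta>) = H (z + r * cis \<theta>)" for \<theta>
    using \<open>0 < r\<close> by (simp add: field_simps)
  ultimately show ?thesis by (simp add: algebra_simps)
qed

lemma complex_curve_has_derivative:
  fixes g :: "complex \<Rightarrow> complex ^ 'n"
  assumes deriv: "\<And>j. ((\<lambda>\<mu>. g \<mu> $ j) has_field_derivative b $ j) (at \<mu>0)"
  shows "(g has_derivative (\<lambda>h. h *s b)) (at \<mu>0)"
  unfolding has_derivative_at_within
proof (intro conjI vec_tendstoI)
  show "bounded_linear (\<lambda>h. h *s b)"
    by (rule bounded_linear_intro[of _ "norm b"])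
      (auto simp: norm_complex_scalar_mult vec_eq_iff algebra_simps)
  fix j
  have "((\<lambda>y. (g y $ j - g \<mu>0 $ j - b $ j * (y - \<mu>0)) /\<^sub>R norm (y - \<mu>0)) \<longlongrightarrow> 0) (at \<mu>0)"
    using deriv[of j] unfolding has_field_derivative_def has_derivative_at_within by simp
  then show "((\<lambda>y. ((g y - g \<mu>0 - (y - \<mu>0) *s b) /\<^sub>R norm (y - \<mu>0)) $ j) \<longlongrightarrow> 0 $ j) (at \<mu>0)"
    by (simp add: right_diff_distrib mult.commute)
qed

section \<open>Maximum principle along analytic discs\<close>

text \<open>
  The penalised function has no interior local maximum. Let \<open>b\<close> be the derivative of \<open>g\<close> at
  \<open>\<mu>0\<close> and \<open>R h\<close> the error of the tangent line, so that
  \<open>g (\<mu>0 + h) + (w0 + R h) = y + h b\<close> with \<open>y = g \<mu>0 + w0\<close>. Comparing the value at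
  \<open>(\<mu>0 + h, w0 + R h)\<close> with the maximum bounds \<open>u (y + h b) - u y\<close> by
  \<open>N (2 R h \<bullet> w0 + |R h|^2) - \<epsilon> (2 h \<bullet> \<mu>0 + |h|^2)\<close>. The terms linear in
  \<open>R h\<close> and \<open>h\<close> are the real part of a holomorphic function vanishing at \<open>0\<close>, so they have mean
  zero on circles. Since \<open>|R h|^2\<close> is of smaller order than \<open>|h|^2\<close>, the mean of \<open>u\<close> over a
  small circle about \<open>y\<close> is strictly less than \<open>u y\<close>.
\<close>

lemma no_touching_disc:
  fixes g :: "complex \<Rightarrow> complex ^ 'n"
  assumes psh: "continuous_psh_on D u"
    and hol: "\<And>j. (\<lambda>\<mu>. g \<mu> $ j) holomorphic_on ball \<mu>0 d"
    and "0 < d" "0 \<le> N" "0 < \<epsilon>"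
    and inD: "\<And>\<mu> w. \<lbrakk>norm (\<mu> - \<mu>0) < d; norm (w - w0) < d\<rbrakk> \<Longrightarrow> g \<mu> + w \<in> D"
    and max: "\<And>\<mu> w. \<lbrakk>norm (\<mu> - \<mu>0) < d; norm (w - w0) < d\<rbrakk> \<Longrightarrow>
      u (g \<mu> + w) - N * (norm w)\<^sup>2 + \<epsilon> * (norm \<mu>)\<^sup>2 \<le>
      u (g \<mu>0 + w0) - N * (norm w0)\<^sup>2 + \<epsilon> * (norm \<mu>0)\<^sup>2"
  shows False
proof -
  \<comment> \<open>With \<open>|R h| \<le> \<eta> |h|\<close> the quadratic error costs at most half of the gain \<open>\<epsilon> |h|^2\<close>;
    the summand \<open>1\<close> covers \<open>N = 0\<close>.\<close>
  define \<eta> where "\<eta> = sqrt (\<epsilon> / (2 * (N + 1)))"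
  have "0 < \<eta>" and \<eta>: "N * \<eta>\<^sup>2 \<le> \<epsilon> / 2"
    using \<open>0 \<le> N\<close> \<open>0 < \<epsilon>\<close> by (auto simp: \<eta>_def field_simps)
  define b where "b = (\<chi> j. deriv (\<lambda>\<mu>. g \<mu> $ j) \<mu>0)"
  have "(g has_derivative (\<lambda>h. h *s b)) (at \<mu>0)"
    using holomorphic_derivI[OF hol open_ball, of \<mu>0] \<open>0 < d\<close>
    by (intro complex_curve_has_derivative) (simp add: b_def)
  then obtain \<delta> where "0 < \<delta>"
    and \<delta>: "\<And>y. norm (y - \<mu>0) < \<delta> \<Longrightarrow> norm (g y - g \<mu>0 - (y - \<mu>0) *s b) \<le> \<eta> * norm (y - \<mu>0)"
    using \<open>0 < \<eta>\<close> unfolding has_derivative_at_alt by meson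
  have tangent: "norm (g \<mu>0 + h *s b - g (\<mu>0 + h)) \<le> \<eta> * norm h" if "norm h < \<delta>" for h
    using \<delta>[of "\<mu>0 + h"] that norm_minus_commute[of "g (\<mu>0 + h)" "g \<mu>0 + h *s b"]
    by (simp add: diff_diff_eq)
  define R where "R h = g \<mu>0 + h *s b - g (\<mu>0 + h)" for h
  \<comment> \<open>The last bound keeps \<open>w0 + R h\<close> within distance \<open>d\<close> of \<open>w0\<close>.\<close>
  define \<rho> where "\<rho> = min (min (d / 2) (\<delta> / 2)) (d / (2 * \<eta>))"
  have "\<eta> * \<rho> \<le> \<eta> * (d / (2 * \<eta>))" using \<open>0 < \<eta>\<close> by (intro mult_left_mono) (auto simp: \<rho>_def)
  also have "\<dots> < d" using \<open>0 < \<eta>\<close> \<open>0 < d\<close> by simp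
  finally have \<rho>: "0 < \<rho>" "\<rho> < d" "\<rho> < \<delta>" "\<eta> * \<rho> < d"
    using \<open>0 < d\<close> \<open>0 < \<delta>\<close> \<open>0 < \<eta>\<close> by (auto simp: \<rho>_def)
  have small: "norm (R h) \<le> \<eta> * norm h" "norm (R h) < d" if "norm h \<le> \<rho>" for h
  proof -
    show *: "norm (R h) \<le> \<eta> * norm h" using tangent[of h] that \<rho> by (simp add: R_def)
    have "\<eta> * norm h \<le> \<eta> * \<rho>" using that \<open>0 < \<eta>\<close> by simp
    with * \<rho> show "norm (R h) < d" by simp
  qed
  define y where "y = g \<mu>0 + w0"
  have split: "g (\<mu>0 + h) + (w0 + R h) = y + h *s b" for h by (simp add: R_def y_def)
  have disc: "y + h *s b \<in> D" if "norm h \<le> \<rho>" for h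
    using inD[of "\<mu>0 + h" "w0 + R h"] small[OF that] that \<rho> by (simp add: split)
  \<comment> \<open>The conjugates are constants here, which is why this is holomorphic in \<open>h\<close>.\<close>
  define H where "H h = 2 * N * (\<Sum>j\<in>UNIV. R h $ j * cnj (w0 $ j)) - 2 * \<epsilon> * (h * cnj \<mu>0)" for h
  have ReH: "Re (H h) = 2 * N * (R h \<bullet> w0) - 2 * \<epsilon> * (h \<bullet> \<mu>0)" for h
    by (simp add: H_def inner_vec_def inner_complex_def)
  have bound: "u (y + h *s b) \<le> u y + Re (H h) - \<epsilon> / 2 * \<rho>\<^sup>2" if "norm h = \<rho>" for h
  proof -
    have "u (y + h *s b) - N * (norm (w0 + R h))\<^sup>2 + \<epsilon> * (norm (\<mu>0 + h))\<^sup>2 \<le>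
        u y - N * (norm w0)\<^sup>2 + \<epsilon> * (norm \<mu>0)\<^sup>2"
      using max[of "\<mu>0 + h" "w0 + R h"] small[of h] that \<rho> unfolding split y_def by simp
    moreover have "(norm (w0 + R h))\<^sup>2 = (norm w0)\<^sup>2 + 2 * (R h \<bullet> w0) + (norm (R h))\<^sup>2"
      by (simp add: power2_norm_eq_inner inner_add_left inner_add_right inner_commute)
    moreover have "(norm (\<mu>0 + h))\<^sup>2 = (norm \<mu>0)\<^sup>2 + 2 * (h \<bullet> \<mu>0) + \<rho>\<^sup>2"
      unfolding that[symmetric]
      by (simp add: power2_norm_eq_inner inner_add_left inner_add_right inner_commute)
    moreover have "N * (norm (R h))\<^sup>2 \<le> \<epsilon> / 2 * \<rho>\<^sup>2"
    proof -
      have "(norm (R h))\<^sup>2 \<le> (\<eta> * \<rho>)\<^sup>2" using small(1)[of h] that by (intro power_mono) auto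
      then have "N * (norm (R h))\<^sup>2 \<le> (N * \<eta>\<^sup>2) * \<rho>\<^sup>2"
        using \<open>0 \<le> N\<close> by (simp add: power_mult_distrib mult_left_mono mult.assoc)
      also have "\<dots> \<le> \<epsilon> / 2 * \<rho>\<^sup>2" using \<eta> by (intro mult_right_mono) auto
      finally show ?thesis .
    qed
    ultimately show ?thesis by (simp add: ReH algebra_simps)
  qed
  have "H holomorphic_on cball 0 \<rho>"
  proof -
    have "(\<lambda>h. g (\<mu>0 + h) $ j) holomorphic_on cball 0 \<rho>" for j
    proof -
      have "(\<lambda>\<mu>. g \<mu> $ j) \<circ> (\<lambda>h. \<mu>0 + h) holomorphic_on cball 0 \<rho>"
        using \<rho> by (intro holomorphic_on_compose_gen[OF _ hol] holomorphic_intros) (auto simp: dist_norm)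
      then show ?thesis by (simp add: o_def)
    qed
    then show ?thesis
      unfolding H_def R_def vector_minus_component vector_add_component vector_smult_component
      by (intro holomorphic_intros)
  qed
  moreover have "H 0 = 0" by (simp add: H_def R_def)
  ultimately have "((\<lambda>\<theta>. H (\<rho> * cis \<theta>)) has_integral 0) {0..2 * pi}"
    using mean_value_circle[of H 0 \<rho>] \<rho> by simp
  from has_integral_Re[OF this]
  have "((\<lambda>\<theta>. (u y - \<epsilon> / 2 * \<rho>\<^sup>2) + Re (H (\<rho> * cis \<theta>))) has_integral
      (2 * pi) * (u y - \<epsilon> / 2 * \<rho>\<^sup>2) + 0) {0..2 * pi}"
    using has_integral_const_real[of "u y - \<epsilon> / 2 * \<rho>\<^sup>2" 0 "2 * pi"]
    by (intro has_integral_add) auto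
  moreover have "(\<lambda>\<theta>. u (y + cis \<theta> *s (\<rho> *s b))) integrable_on {0..2 * pi}"
  proof -
    have "continuous_on {0..2 * pi} (\<lambda>\<theta>. u (y + cis \<theta> *s (\<rho> *s b)))"
    proof (rule continuous_on_compose2[of D u])
      show "continuous_on D u" using psh by (simp add: continuous_psh_on_def)
      show "continuous_on {0..2 * pi} (\<lambda>\<theta>. y + cis \<theta> *s (\<rho> *s b))"
        by (intro continuous_intros)
      show "(\<lambda>\<theta>. y + cis \<theta> *s (\<rho> *s b)) ` {0..2 * pi} \<subseteq> D"
        using disc \<rho> by (auto simp: vector_smult_assoc norm_mult)
    qed
    then show ?thesis by (rule integrable_continuous_real)
  qed
  ultimately have "integral {0..2 * pi} (\<lambda>\<theta>. u (y + cis \<theta> *s (\<rho> *s b)))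
      \<le> (2 * pi) * (u y - \<epsilon> / 2 * \<rho>\<^sup>2) + 0"
  proof (intro has_integral_le[OF integrable_integral])
    fix \<theta> :: real
    show "u (y + cis \<theta> *s (\<rho> *s b)) \<le> (u y - \<epsilon> / 2 * \<rho>\<^sup>2) + Re (H (\<rho> * cis \<theta>))"
      using bound[of "\<rho> * cis \<theta>"] \<rho> by (simp add: norm_mult vector_smult_assoc mult.commute)
  qed
  moreover have "y + \<mu> *s (\<rho> *s b) \<in> D" if "norm \<mu> \<le> 1" for \<mu>
    using disc[of "\<mu> * \<rho>"] \<rho> that by (simp add: norm_mult vector_smult_assoc mult_left_le_one_le)
  then have "u y \<le> 1 / (2 * pi) * integral {0..2 * pi} (\<lambda>\<theta>. u (y + cis \<theta> *s (\<rho> *s b)))"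
    using psh unfolding continuous_psh_on_def by blast
  then have "2 * pi * u y \<le> integral {0..2 * pi} (\<lambda>\<theta>. u (y + cis \<theta> *s (\<rho> *s b)))"
    by (simp only: mult.commute divide_inverse) (simp add: field_simps)
  ultimately have "2 * pi * u y \<le> 2 * pi * (u y - \<epsilon> / 2 * \<rho>\<^sup>2)" by linarith
  then have "u y \<le> u y - \<epsilon> / 2 * \<rho>\<^sup>2" by (rule mult_left_le_imp_le) simp
  with \<rho> \<open>0 < \<epsilon>\<close> show False by (simp add: mult_le_0_iff)
qed


text \<open>
  If the bound failed inside the disc, the penalised function, taken over \<open>\<mu>\<close> in the closed disc
  and small \<open>w\<close>, would attain its maximum at some \<open>(\<mu>0, w0)\<close>. A large penalty \<open>N\<close> forces \<open>w0\<close> to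
  be so small that uniform continuity of \<open>u\<close> excludes \<open>\<mu>0\<close> on the unit circle; the maximum is
  then interior in both variables, which \<open>no_touching_disc\<close> forbids.
\<close>

lemma psh_maximum_principle:
  fixes g :: "complex \<Rightarrow> complex ^ 'n"
  assumes "open D" and psh: "continuous_psh_on D u"
    and cont: "continuous_on (cball 0 1) g"
    and hol: "\<And>j. (\<lambda>\<mu>. g \<mu> $ j) holomorphic_on ball 0 1"
    and "g ` cball 0 1 \<subseteq> D"
    and bdry: "\<And>\<mu>. norm \<mu> = 1 \<Longrightarrow> u (g \<mu>) \<le> M"
    and "norm \<mu>1 \<le> 1"
  shows "u (g \<mu>1) \<le> M"
proof (rule ccontr)
  assume "\<not> u (g \<mu>1) \<le> M"
  \<comment> \<open>One third of the excess for the oscillation of \<open>u\<close>, one for the term \<open>\<gamma> |\<mu>|^2\<close>,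
    and one to keep a strict inequality.\<close>
  define \<gamma> where "\<gamma> = (u (g \<mu>1) - M) / 3"
  have "0 < \<gamma>" using \<open>\<not> u (g \<mu>1) \<le> M\<close> by (simp add: \<gamma>_def)
  have "compact (g ` cball 0 1)" by (intro compact_continuous_image cont) simp
  then obtain e where "0 < e" and e: "(\<Union>x\<in>g ` cball 0 1. ball x e) \<subseteq> D"
    using compact_subset_open_imp_ball_epsilon_subset[OF _ \<open>open D\<close>] assms(5) by metis
  define r where "r = e / 2"
  have "0 < r" "r < e" using \<open>0 < e\<close> by (auto simp: r_def)
  define K where "K = {x + w |x w. x \<in> g ` cball 0 1 \<and> w \<in> cball 0 r}"
  have "compact K"
    unfolding K_def using \<open>compact (g ` cball 0 1)\<close> by (intro compact_sums) auto
  have inK: "g \<mu> + w \<in> K" if "norm \<mu> \<le> 1" "norm w \<le> r" for \<mu> w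
    using that unfolding K_def by fastforce
  have "K \<subseteq> D"
  proof
    fix x assume "x \<in> K"
    then obtain \<mu> w where x: "x = g \<mu> + w" "norm \<mu> \<le> 1" "norm w \<le> r" by (auto simp: K_def)
    then have "x \<in> ball (g \<mu>) e" using \<open>r < e\<close> by (simp add: dist_norm)
    moreover have "g \<mu> \<in> g ` cball 0 1" using x by auto
    ultimately show "x \<in> D" using e by blast
  qed
  have contu: "continuous_on K u"
    using psh \<open>K \<subseteq> D\<close> by (auto simp: continuous_psh_on_def intro: continuous_on_subset)
  then have "uniformly_continuous_on K u" using \<open>compact K\<close> by (rule compact_uniformly_continuous)
  then obtain \<eta> where "0 < \<eta>"
    and \<eta>: "\<And>x y. \<lbrakk>x \<in> K; y \<in> K; dist y x < \<eta>\<rbrakk> \<Longrightarrow> dist (u y) (u x) < \<gamma>"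
    using \<open>0 < \<gamma>\<close> unfolding uniformly_continuous_on_def by meson
  have "bounded (u ` K)" using compact_continuous_image[OF contu \<open>compact K\<close>] by (rule compact_imp_bounded)
  then obtain B where B: "\<And>x. x \<in> K \<Longrightarrow> \<bar>u x\<bar> \<le> B" unfolding bounded_iff by auto
  define s where "s = min \<eta> r"
  have s: "0 < s" "s \<le> \<eta>" "s \<le> r" using \<open>0 < \<eta>\<close> \<open>0 < r\<close> by (auto simp: s_def)
  \<comment> \<open>A shift of norm at least \<open>s\<close> costs more than the oscillation \<open>2 B\<close> of \<open>u\<close> plus \<open>\<gamma>\<close>.\<close>
  define N where "N = (2 * \<bar>B\<bar> + \<gamma> + 1) / s\<^sup>2"
  have "0 \<le> N" and N: "N * s\<^sup>2 = 2 * \<bar>B\<bar> + \<gamma> + 1" using s \<open>0 < \<gamma>\<close> by (auto simp: N_def)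
  define F where "F = (\<lambda>(\<mu>, w). u (g \<mu> + w) - N * (norm w)\<^sup>2 + \<gamma> * (norm \<mu>)\<^sup>2)"
  have "continuous_on (cball 0 1 \<times> cball 0 r) (\<lambda>x. u (g (fst x) + snd x))"
    by (rule continuous_on_compose2[OF contu])
      (auto intro!: continuous_intros continuous_on_compose2[OF cont] inK)
  then have "continuous_on (cball 0 1 \<times> cball 0 r) F"
    unfolding F_def case_prod_unfold by (intro continuous_intros)
  moreover have "compact (cball (0::complex) 1 \<times> cball (0::complex ^ 'n) r)" by (intro compact_Times) auto
  moreover have "cball (0::complex) 1 \<times> cball (0::complex ^ 'n) r \<noteq> {}" using \<open>0 < r\<close> by auto
  ultimately obtain \<mu>0 w0 where \<mu>0: "norm \<mu>0 \<le> 1" and w0: "norm w0 \<le> r"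
    and max: "\<And>\<mu> w. norm \<mu> \<le> 1 \<Longrightarrow> norm w \<le> r \<Longrightarrow> F (\<mu>, w) \<le> F (\<mu>0, w0)"
    using continuous_attains_sup[of "cball 0 1 \<times> cball 0 r" F] by (force simp: mem_Times_iff)
  have "u (g \<mu>1) \<le> F (\<mu>1, 0)" using \<open>0 < \<gamma>\<close> by (simp add: F_def)
  also have "\<dots> \<le> F (\<mu>0, w0)" using max \<open>0 < r\<close> \<open>norm \<mu>1 \<le> 1\<close> by simp
  also have "\<dots> \<le> u (g \<mu>0 + w0) - N * (norm w0)\<^sup>2 + \<gamma>"
    using \<mu>0 \<open>0 < \<gamma>\<close> by (simp add: F_def power_le_one)
  finally have upper: "u (g \<mu>1) \<le> u (g \<mu>0 + w0) - N * (norm w0)\<^sup>2 + \<gamma>" .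
  have "norm w0 < s"
  proof (rule ccontr)
    assume "\<not> norm w0 < s"
    then have "N * s\<^sup>2 \<le> N * (norm w0)\<^sup>2" using s \<open>0 \<le> N\<close> by (intro mult_left_mono power_mono) auto
    moreover have "\<bar>u (g \<mu>1)\<bar> \<le> B" using B[of "g \<mu>1"] inK[of \<mu>1 0] \<open>norm \<mu>1 \<le> 1\<close> \<open>0 < r\<close> by simp
    moreover have "\<bar>u (g \<mu>0 + w0)\<bar> \<le> B" using B inK \<mu>0 w0 by simp
    ultimately show False using upper N by linarith
  qed
  have "norm \<mu>0 \<noteq> 1"
  proof
    assume "norm \<mu>0 = 1"
    then have "u (g \<mu>0) \<le> M" by (rule bdry)
    moreover have "dist (u (g \<mu>0 + w0)) (u (g \<mu>0)) < \<gamma>"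
      using \<eta>[of "g \<mu>0" "g \<mu>0 + w0"] inK[of \<mu>0 0] inK[OF \<mu>0 w0] \<mu>0 \<open>norm w0 < s\<close> s \<open>0 < r\<close>
      by (simp add: dist_norm)
    then have "u (g \<mu>0 + w0) < u (g \<mu>0) + \<gamma>" by (simp add: dist_real_def abs_less_iff)
    moreover have "0 \<le> N * (norm w0)\<^sup>2" using \<open>0 \<le> N\<close> by simp
    moreover have "u (g \<mu>1) = M + 3 * \<gamma>" by (simp add: \<gamma>_def field_simps)
    ultimately show False using upper \<open>0 < \<gamma>\<close> by linarith
  qed
  define d where "d = min (1 - norm \<mu>0) (r - norm w0)"
  have "0 < d" using \<mu>0 \<open>norm \<mu>0 \<noteq> 1\<close> \<open>norm w0 < s\<close> s by (simp add: d_def)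
  have inside: "norm \<mu> < 1" "norm w \<le> r" if "norm (\<mu> - \<mu>0) < d" "norm (w - w0) < d" for \<mu> w
    using that norm_triangle_sub[of \<mu> \<mu>0] norm_triangle_sub[of w w0] by (auto simp: d_def)
  show False
  proof (rule no_touching_disc[OF psh _ \<open>0 < d\<close> \<open>0 \<le> N\<close> \<open>0 < \<gamma>\<close>])
    show "(\<lambda>\<mu>. g \<mu> $ j) holomorphic_on ball \<mu>0 d" for j
      using inside(1)[of _ w0] \<open>0 < d\<close>
      by (intro holomorphic_on_subset[OF hol]) (auto simp: dist_norm norm_minus_commute)
    show "g \<mu> + w \<in> D" if "norm (\<mu> - \<mu>0) < d" "norm (w - w0) < d" for \<mu> w
      using inside[OF that] inK \<open>K \<subseteq> D\<close> by (auto simp: less_imp_le)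
    show "u (g \<mu> + w) - N * (norm w)\<^sup>2 + \<gamma> * (norm \<mu>)\<^sup>2 \<le>
        u (g \<mu>0 + w0) - N * (norm w0)\<^sup>2 + \<gamma> * (norm \<mu>0)\<^sup>2"
      if "norm (\<mu> - \<mu>0) < d" "norm (w - w0) < d" for \<mu> w
      using max[of \<mu> w] inside[OF that] by (simp add: F_def)
  qed
qed

section \<open>Continuity principle\<close>

text \<open>
  Let \<open>A\<close> be the set of parameters whose disc lies in \<open>D\<close>. It is relatively open because \<open>D\<close> is
  open and the closed disc is compact. The boundaries of all discs together form a compact subset
  of \<open>D\<close>, on which the exhaustion function is bounded by some \<open>c\<close>; by the maximum principle a
  disc in \<open>D\<close> already lies in the compact sublevel set at height \<open>c\<close>, and this second description
  shows that \<open>A\<close> is closed.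
\<close>

lemma pseudoconvex_continuity_principle:
  fixes G :: "real \<Rightarrow> complex \<Rightarrow> complex ^ 'n"
  assumes "open D" "pseudoconvex D"
    and cont: "continuous_on ({0..1} \<times> cball 0 1) (\<lambda>(s, \<mu>). G s \<mu>)"
    and hol: "\<And>s j. s \<in> {0..1} \<Longrightarrow> (\<lambda>\<mu>. G s \<mu> $ j) holomorphic_on ball 0 1"
    and bdry: "\<And>s \<mu>. \<lbrakk>s \<in> {0..1}; norm \<mu> = 1\<rbrakk> \<Longrightarrow> G s \<mu> \<in> D"
    and start: "\<And>\<mu>. norm \<mu> \<le> 1 \<Longrightarrow> G 0 \<mu> \<in> D"
    and "norm \<mu> \<le> 1"
  shows "G 1 \<mu> \<in> D"
proof -
  obtain u where psh: "continuous_psh_on D u" and exh: "\<And>c. compact {z \<in> D. u z \<le> c}"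
    using \<open>pseudoconvex D\<close> unfolding pseudoconvex_def by blast
  have contu: "continuous_on D u" using psh by (simp add: continuous_psh_on_def)
  let ?G = "\<lambda>(s, \<mu>). G s \<mu>"
  define T where "T = {0..1::real} \<times> sphere (0::complex) 1"
  have "continuous_on T ?G"
    by (rule continuous_on_subset[OF cont]) (auto simp: T_def)
  then have "continuous_on T (\<lambda>x. u (?G x))"
    by (rule continuous_on_compose2[OF contu]) (auto simp: T_def bdry)
  moreover have "compact T" unfolding T_def by (intro compact_Times) auto
  ultimately have "bounded ((\<lambda>x. u (?G x)) ` T)"
    by (intro compact_imp_bounded compact_continuous_image)
  then obtain c where c_abs: "\<forall>x\<in>T. \<bar>u (?G x)\<bar> \<le> c" unfolding bounded_iff by auto
  have c: "u (G s \<mu>) \<le> c" if "s \<in> {0..1}" "norm \<mu> = 1" for s \<mu>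
    using bspec[OF c_abs, of "(s, \<mu>)"] that by (simp add: T_def)
  define L where "L = {z \<in> D. u z \<le> c}"
  define A where "A = {s \<in> {0..1}. \<forall>\<mu>\<in>cball 0 1. G s \<mu> \<in> D}"
  have A_eq: "A = {s \<in> {0..1}. \<forall>\<mu>\<in>cball 0 1. G s \<mu> \<in> L}"
  proof -
    have "u (G s \<mu>) \<le> c" if "s \<in> A" "norm \<mu> \<le> 1" for s \<mu>
    proof (rule psh_maximum_principle[OF \<open>open D\<close> psh])
      show "continuous_on (cball 0 1) (G s)"
      proof -
        have "continuous_on (cball 0 1) (\<lambda>\<mu>. ?G (s, \<mu>))"
          by (rule continuous_on_compose2[OF cont])
            (use that in \<open>auto simp: A_def intro!: continuous_intros\<close>)
        then show ?thesis by simp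
      qed
    qed (use that hol c in \<open>auto simp: A_def\<close>)
    then show ?thesis by (auto simp: A_def L_def)
  qed
  have slice: "continuous_on {0..1} (\<lambda>s. G s \<mu>)" if "norm \<mu> \<le> 1" for \<mu>
  proof -
    have "continuous_on {0..1} (\<lambda>s. ?G (s, \<mu>))"
      by (rule continuous_on_compose2[OF cont]) (use that in \<open>auto intro!: continuous_intros\<close>)
    then show ?thesis by simp
  qed
  have "closed L" using exh unfolding L_def by (rule compact_imp_closed)
  have "closed ({0..1} \<inter> (\<Inter>\<mu>\<in>cball 0 1. {0..1} \<inter> (\<lambda>s. G s \<mu>) -` L))"
    by (intro closed_Int closed_INT ballI continuous_closed_preimage slice \<open>closed L\<close>) auto
  also have "{0..1} \<inter> (\<Inter>\<mu>\<in>cball 0 1. {0..1} \<inter> (\<lambda>s. G s \<mu>) -` L) = A"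
    unfolding A_eq by auto
  finally have "closed A" .
  \<comment> \<open>The complement of \<open>A\<close> in \<open>[0, 1]\<close> is the projection of a compact set along the closed disc.\<close>
  have "closed (({0..1} \<times> cball 0 1) \<inter> ?G -` (- D))"
    using \<open>open D\<close> by (intro continuous_closed_preimage cont) (auto intro: closed_Times)
  moreover have "compact ({0..1::real} \<times> cball (0::complex) 1)" by (intro compact_Times) auto
  ultimately have "compact (({0..1} \<times> cball 0 1) \<inter> (({0..1} \<times> cball 0 1) \<inter> ?G -` (- D)))"
    by (intro compact_Int_closed)
  then have "compact (fst ` (({0..1} \<times> cball 0 1) \<inter> (({0..1} \<times> cball 0 1) \<inter> ?G -` (- D))))"
    by (intro compact_continuous_image continuous_intros)
  also have "fst ` (({0..1} \<times> cball 0 1) \<inter> (({0..1} \<times> cball 0 1) \<inter> ?G -` (- D))) = {0..1} - A"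
    by (force simp: A_def image_iff)
  finally have "closed ({0..1} - A)" by (rule compact_imp_closed)
  have "A \<subseteq> {0..1}" by (auto simp: A_def)
  have "openin (top_of_set {0..1}) A"
    using \<open>closed ({0..1} - A)\<close> \<open>A \<subseteq> {0..1}\<close>
    by (simp add: openin_closedin_eq closed_subset)
  moreover have "closedin (top_of_set {0..1}) A"
    using \<open>closed A\<close> \<open>A \<subseteq> {0..1}\<close> by (simp add: closed_subset)
  moreover have "connected {0..1::real}" by simp
  moreover have "0 \<in> A" using start by (auto simp: A_def)
  ultimately have "A = {0..1}" unfolding connected_clopen by blast
  then have "1 \<in> A" by simp
  with \<open>norm \<mu> \<le> 1\<close> show ?thesis by (simp add: A_def)
qed

section \<open>Discs in quasi-balanced domains\<close>

lemma wscale_wscale: "wscale p a (wscale p b z) = wscale p (a * b) z"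
  by (simp add: wscale_def vec_eq_iff power_mult_distrib mult.assoc)

lemma wscale_one: "wscale p 1 z = z"
  by (simp add: wscale_def vec_eq_iff)

lemma wscale_zero: "\<forall>i. 0 < p i \<Longrightarrow> wscale p 0 z = 0"
  by (simp add: wscale_def vec_eq_iff)

text \<open>
  The weighted contractions of the disc \<open>g\<close> join it to the constant disc \<open>0\<close> and keep its
  boundary in \<open>D\<close>, so the continuity principle applies.
\<close>

lemma quasi_balanced_disc_filling:
  fixes g :: "complex \<Rightarrow> complex ^ 'n"
  assumes "\<forall>i. 0 < p i" "open D" "pseudoconvex D" "quasi_balanced p D"
    and cont: "continuous_on (cball 0 1) g"
    and hol: "\<And>j. (\<lambda>\<mu>. g \<mu> $ j) holomorphic_on ball 0 1"
    and bdry: "\<And>\<mu>. norm \<mu> = 1 \<Longrightarrow> g \<mu> \<in> D"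
    and "norm \<mu> \<le> 1"
  shows "g \<mu> \<in> D"
proof -
  have "wscale p 0 (g 1) \<in> D" using \<open>quasi_balanced p D\<close> bdry[of 1] by (simp add: quasi_balanced_def)
  then have "0 \<in> D" by (simp add: wscale_zero[OF assms(1)])
  have "wscale p (complex_of_real 1) (g \<mu>) \<in> D"
  proof (rule pseudoconvex_continuity_principle[OF \<open>open D\<close> \<open>pseudoconvex D\<close>,
        where G = "\<lambda>s \<mu>. wscale p (complex_of_real s) (g \<mu>)"])
    show "continuous_on ({0..1} \<times> cball 0 1) (\<lambda>(s, \<mu>). wscale p (complex_of_real s) (g \<mu>))"
      unfolding case_prod_unfold wscale_def
      by (intro continuous_intros continuous_on_compose2[OF cont]) auto
    show "(\<lambda>\<mu>. wscale p (complex_of_real s) (g \<mu>) $ j) holomorphic_on ball 0 1" for s j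
      using hol by (auto simp: wscale_def intro!: holomorphic_intros)
    show "wscale p (complex_of_real s) (g \<mu>) \<in> D" if "s \<in> {0..1}" "norm \<mu> = 1" for s \<mu>
      using \<open>quasi_balanced p D\<close> bdry that by (simp add: quasi_balanced_def)
    show "wscale p (complex_of_real 0) (g \<mu>) \<in> D" for \<mu>
      using \<open>0 \<in> D\<close> wscale_zero[OF assms(1)] by simp
  qed fact
  then show ?thesis by (simp add: wscale_one)
qed

text \<open>
  A Schwarz lemma: where the classical one divides by \<open>\<zeta>\<close>, here the weighted action is divided
  off. The root \<open>\<zeta> = \<mu>^P\<close>, with \<open>P\<close> the highest weight, makes all the exponents \<open>P - p\<^sub>j\<close>
  of the quotient nonnegative, so that the quotient is again a holomorphic disc.
\<close>

lemma quasi_balanced_schwarz: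
  fixes \<phi> :: "complex \<Rightarrow> complex ^ 'n"
  assumes "\<forall>i. 0 < p i" "open D" "pseudoconvex D" "quasi_balanced p D"
    and "open S" "cball 0 1 \<subseteq> S"
    and hol: "\<And>j. (\<lambda>\<zeta>. \<phi> \<zeta> $ j) holomorphic_on S"
    and inD: "\<And>\<zeta>. norm \<zeta> \<le> 1 \<Longrightarrow> \<phi> \<zeta> \<in> D" and "\<phi> 0 = 0" and "norm \<mu> \<le> 1"
  obtains v where "v \<in> D" "\<phi> (\<mu> ^ highest_weight p) = wscale p \<mu> v"
proof -
  define P where "P = highest_weight p"
  have le_P: "p j \<le> P" for j by (simp add: P_def highest_weight_def)
  \<comment> \<open>Subtracting \<open>\<phi> 0 = 0\<close> and \<open>0\<close> puts \<open>\<psi>\<close> literally in the form of \<open>pole_lemma_open\<close>.\<close>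
  define \<psi> where "\<psi> j \<zeta> = (if \<zeta> = 0 then deriv (\<lambda>\<zeta>. \<phi> \<zeta> $ j) 0 else (\<phi> \<zeta> $ j - \<phi> 0 $ j) / (\<zeta> - 0))" for j \<zeta>
  have hol_\<psi>: "\<psi> j holomorphic_on S" for j
    unfolding \<psi>_def by (rule pole_lemma_open[OF hol \<open>open S\<close>])
  have \<phi>_\<psi>: "\<phi> \<zeta> $ j = \<zeta> * \<psi> j \<zeta>" for j \<zeta> by (simp add: \<psi>_def \<open>\<phi> 0 = 0\<close>)
  define g where "g \<mu> = (\<chi> j. \<mu> ^ (P - p j) * \<psi> j (\<mu> ^ P))" for \<mu>
  have \<phi>_g: "\<phi> (\<mu> ^ P) = wscale p \<mu> (g \<mu>)" for \<mu>
    using le_P by (simp add: vec_eq_iff wscale_def g_def \<phi>_\<psi> power_add[symmetric] mult.assoc[symmetric])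
  have hol_g: "(\<lambda>\<mu>. g \<mu> $ j) holomorphic_on cball 0 1" for j
  proof -
    have "\<psi> j \<circ> (\<lambda>\<mu>. \<mu> ^ P) holomorphic_on cball 0 1"
      using \<open>cball 0 1 \<subseteq> S\<close>
      by (intro holomorphic_on_compose_gen[OF _ hol_\<psi>] holomorphic_intros)
        (auto simp: norm_power power_le_one)
    then show ?thesis unfolding g_def vec_lambda_beta o_def by (intro holomorphic_intros)
  qed
  have "g \<mu> \<in> D"
  proof (rule quasi_balanced_disc_filling[OF assms(1-4)])
    have "continuous_on (cball 0 1) (\<lambda>\<mu>. \<chi> j. g \<mu> $ j)"
      by (intro continuous_intros holomorphic_on_imp_continuous_on hol_g)
    then show "continuous_on (cball 0 1) g" by simp
    show "(\<lambda>\<mu>. g \<mu> $ j) holomorphic_on ball 0 1" for j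
      by (rule holomorphic_on_subset[OF hol_g]) auto
    show "g \<mu> \<in> D" if "norm \<mu> = 1" for \<mu>
    proof -
      have "\<mu> \<noteq> 0" using that by auto
      then have "g \<mu> = wscale p (inverse \<mu>) (\<phi> (\<mu> ^ P))"
        by (simp add: \<phi>_g wscale_wscale wscale_one)
      moreover have "\<phi> (\<mu> ^ P) \<in> D" using inD that by (simp add: norm_power)
      ultimately show ?thesis
        using \<open>quasi_balanced p D\<close> that by (simp add: quasi_balanced_def norm_inverse)
    qed
  qed fact
  then show thesis using that[OF _ \<phi>_g[unfolded P_def]] by blast
qed

lemma holomorphic_on_weighted_orbit:
  fixes f :: "complex ^ 'n \<Rightarrow> complex ^ 'm"
  assumes "holomorphic_map_on f D"
  shows "(\<lambda>\<zeta>. f (wscale p \<zeta> w) $ j) holomorphic_on {\<zeta>. wscale p \<zeta> w \<in> D}"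
proof (rule holomorphic_onI, rule field_differentiable_at_within)
  fix \<zeta> assume "\<zeta> \<in> {\<zeta>. wscale p \<zeta> w \<in> D}"
  then obtain f' where f': "(f has_derivative f') (at (wscale p \<zeta> w))"
    and lin: "\<And>c v. f' (c *s v) = c *s f' v"
    using assms unfolding holomorphic_map_on_def by blast
  define v where "v = (\<chi> i. of_nat (p i) * \<zeta> ^ (p i - 1) * w $ i)"
  have "((\<lambda>\<zeta>. wscale p \<zeta> w) has_derivative (\<lambda>h. h *s v)) (at \<zeta>)"
    by (rule complex_curve_has_derivative)
      (auto simp: wscale_def v_def intro!: derivative_eq_intros)
  from has_derivative_compose[OF this f']
  have "((\<lambda>\<zeta>. f (wscale p \<zeta> w)) has_derivative (\<lambda>h. h *s f' v)) (at \<zeta>)"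
    by (simp add: lin)
  from bounded_linear.has_derivative[OF bounded_linear_vec_nth this, of j]
  have "((\<lambda>\<zeta>. f (wscale p \<zeta> w) $ j) has_field_derivative f' v $ j) (at \<zeta>)"
    by (simp add: has_field_derivative_def mult.commute[of _ "f' v $ j"])
  then show "(\<lambda>\<zeta>. f (wscale p \<zeta> w) $ j) field_differentiable at \<zeta>"
    unfolding field_differentiable_def by blast
qed

section \<open>The Minkowski function\<close>

lemma minkowski_le:
  assumes "0 < t" "wscale p (complex_of_real (1 / t)) z \<in> D"
  shows "minkowski p D z \<le> t"
  unfolding minkowski_def using assms by (intro cInf_lower) (auto intro!: bdd_belowI[of _ 0])

lemma minkowski_nonneg:
  assumes "z \<in> D"
  shows "0 \<le> minkowski p D z"
  unfolding minkowski_def using assms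
  by (intro cInf_greatest) (auto intro!: exI[of _ 1] simp: wscale_one)

section \<open>The contraction property of holomorphic maps\<close>

theorem theorem24:
  fixes D1 :: "(complex ^ 'n) set" and D2 :: "(complex ^ 'm) set"
    and p1 :: "'n \<Rightarrow> nat" and p2 :: "'m \<Rightarrow> nat"
    and f :: "complex ^ 'n \<Rightarrow> complex ^ 'm"
  assumes "weights p1" and "weights p2"
    and "cdomain D1" and "pseudoconvex D1" and "quasi_balanced p1 D1"
    and "cdomain D2" and "pseudoconvex D2" and "quasi_balanced p2 D2"
    and "holomorphic_map_on f D1" and "f ` D1 \<subseteq> D2" and "f 0 = 0"
  shows "\<forall>z\<in>D1. minkowski p2 D2 (f z) ^ highest_weight p2 \<le> minkowski p1 D1 z"
proof
  fix z assume "z \<in> D1"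
  define P where "P = highest_weight p2"
  have pos1: "\<forall>i. 0 < p1 i" and pos2: "\<forall>i. 0 < p2 i"
    using \<open>weights p1\<close> \<open>weights p2\<close> by (auto simp: weights_def)
  have "0 < P" unfolding P_def highest_weight_def using pos2 by (simp add: Max_gr_iff)
  have "open D1" "open D2" using \<open>cdomain D1\<close> \<open>cdomain D2\<close> by (auto simp: cdomain_def)
  have "f z \<in> D2" using \<open>z \<in> D1\<close> \<open>f ` D1 \<subseteq> D2\<close> by blast
  have nonneg: "0 \<le> minkowski p2 D2 (f z)" using \<open>f z \<in> D2\<close> by (rule minkowski_nonneg)
  show "minkowski p2 D2 (f z) ^ highest_weight p2 \<le> minkowski p1 D1 z"
    unfolding minkowski_def[of p1] P_def[symmetric]
  proof (rule cInf_greatest)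
    show "{t. 0 < t \<and> wscale p1 (complex_of_real (1 / t)) z \<in> D1} \<noteq> {}"
      using \<open>z \<in> D1\<close> by (auto intro!: exI[of _ 1] simp: wscale_one)
    fix t assume "t \<in> {t. 0 < t \<and> wscale p1 (complex_of_real (1 / t)) z \<in> D1}"
    then have "0 < t" and w: "wscale p1 (complex_of_real (1 / t)) z \<in> D1" by auto
    show "minkowski p2 D2 (f z) ^ P \<le> t"
    proof (cases "t \<le> 1")
      case False
      \<comment> \<open>The point \<open>t\<close> is outside the unit disc, but \<open>f z \<in> D2\<close> already gives the bound \<open>1\<close>.\<close>
      have "minkowski p2 D2 (f z) \<le> 1" using \<open>f z \<in> D2\<close> by (intro minkowski_le) (auto simp: wscale_one)
      then have "minkowski p2 D2 (f z) ^ P \<le> 1" using nonneg by (intro power_le_one)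
      with False show ?thesis by simp
    next
      case True
      define w where "w = wscale p1 (complex_of_real (1 / t)) z"
      define S where "S = {\<zeta>. wscale p1 \<zeta> w \<in> D1}"
      define \<mu> where "\<mu> = root P t"
      have \<mu>: "0 < \<mu>" "\<mu> \<le> 1" "\<mu> ^ P = t"
        using \<open>0 < P\<close> \<open>0 < t\<close> True by (auto simp: \<mu>_def)
      have in_S: "\<zeta> \<in> S" if "norm \<zeta> \<le> 1" for \<zeta>
        using \<open>quasi_balanced p1 D1\<close> w that by (simp add: S_def w_def quasi_balanced_def)
      have "open ((\<lambda>\<zeta>. wscale p1 \<zeta> w) -` D1)"
        unfolding wscale_def by (intro open_vimage[OF \<open>open D1\<close>] continuous_intros)
      then have "open S" by (simp add: S_def vimage_def)
      have f_zero: "f (wscale p1 0 w) = 0" using \<open>f 0 = 0\<close> by (simp add: wscale_zero[OF pos1])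
      obtain v where "v \<in> D2"
        and v: "f (wscale p1 (complex_of_real \<mu> ^ highest_weight p2) w) = wscale p2 (complex_of_real \<mu>) v"
      proof (rule quasi_balanced_schwarz[OF pos2 \<open>open D2\<close> \<open>pseudoconvex D2\<close> \<open>quasi_balanced p2 D2\<close> \<open>open S\<close>])
        show "(\<lambda>\<zeta>. f (wscale p1 \<zeta> w) $ j) holomorphic_on S" for j
          unfolding S_def by (rule holomorphic_on_weighted_orbit) fact
        show "f (wscale p1 \<zeta> w) \<in> D2" if "norm \<zeta> \<le> 1" for \<zeta>
          using in_S[OF that] \<open>f ` D1 \<subseteq> D2\<close> by (auto simp: S_def)
        show "norm (complex_of_real \<mu>) \<le> 1" using \<mu> by simp
      qed (use in_S f_zero in auto)
      have "wscale p1 (complex_of_real \<mu> ^ highest_weight p2) w = z"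
        using \<mu>(3) \<open>0 < t\<close>
        by (simp add: P_def[symmetric] w_def wscale_wscale wscale_one flip: of_real_power)
      with v have "wscale p2 (complex_of_real (1 / \<mu>)) (f z) = v"
        using \<mu>(1) by (simp add: wscale_wscale wscale_one)
      with \<open>v \<in> D2\<close> \<mu>(1) have "minkowski p2 D2 (f z) \<le> \<mu>" by (intro minkowski_le) auto
      then have "minkowski p2 D2 (f z) ^ P \<le> \<mu> ^ P" using nonneg by (intro power_mono)
      with \<mu>(3) show ?thesis by simp
    qed
  qed
qed

end
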